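(* Let $\mathcal{G}$ be a strongly connected network of period $1$, and let $\rho$ be its Perron eigenvalue. For a node $i$ let $a_i(\ell)$ be the number of walks of length $\ell$ in $\mathcal{G}$ terminating at $i$. Then for each node $i$ there exists a constant $C>0$ (which may depend on $i$) such that $a_i(\ell)\sim C\rho^\ell$ as $\ell\to\infty$.
   Context: A network is a finite directed multigraph (self-loops and multiple edges allowed). If its nodes are $1,\dots,n$, its adjacency matrix is the $n\times n$ matrix $A$ whose $(i,j)$ entry is the number of edges from $i$ to $j$. A walk of length $\ell$ from $j$ to $i$ is a sequence of nodes and edges $i=x_0\stackrel{e_1}{\leftarrow}x_1\stackrel{e_2}{\leftarrow}\cdots\stackrel{e_\ell}{\leftarrow}x_\ell=j$ with $e_t$ an edge from $x_t$ to $x_{t-1}$ (for $\ell=0$ it is a single node); it terminates at $i$. Different parallel edges give different walks; nodes and edges may repeat. A network is strongly connected if for any two distinct nodes $i,j$ there is a walk from $i$ to $j$. The period of a strongly connected network (with at least one edge) is $\gcd\{m>0 : (A^m)_{ii}>0\}$, which is independent of $i$. The Perron eigenvalue of the network is the spectral radius of $A$, which is itself an eigenvalue of $A$. $f(\ell)\sim g(\ell)$ means $f(\ell)/g(\ell)\to 1$. *)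

theory Defs
  imports
    "HOL-Library.Landau_Symbols"
    "Graph_Theory.Digraph_Component"
    "Graph_Theory.Arc_Walk"
    "Jordan_Normal_Form.Spectral_Radius"
begin

text \<open>
  A network is a \<open>fin_digraph\<close>: finitely many vertices and arcs, with loops and parallel
  arcs allowed. Matrices are indexed by natural numbers, so the nodes are numbered by a
  duplicate-free list \<open>vs\<close> enumerating \<open>verts G\<close>; row and column \<open>i\<close> belong to \<open>vs ! i\<close>.
\<close>

definition adjacency_matrix :: "('a, 'b) pre_digraph \<Rightarrow> 'a list \<Rightarrow> nat mat" where
  "adjacency_matrix G vs = mat (length vs) (length vs)
     (\<lambda>(i, j). card {e \<in> arcs G. tail G e = vs ! i \<and> head G e = vs ! j})"

text \<open>
  For a strongly connected network the period does not depend on the node \<open>vs ! i\<close> at which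
  it is computed. If there is no arc, the set is empty and the value is 0.
\<close>

definition period_at :: "('a, 'b) pre_digraph \<Rightarrow> 'a list \<Rightarrow> nat \<Rightarrow> nat" where
  "period_at G vs i = Gcd {m. m > 0 \<and> (adjacency_matrix G vs ^\<^sub>m m) $$ (i, i) > 0}"

definition perron_eigenvalue :: "('a, 'b) pre_digraph \<Rightarrow> 'a list \<Rightarrow> real" where
  "perron_eigenvalue G vs = spectral_radius (map_mat of_nat (adjacency_matrix G vs))"

text \<open>
  A walk is given by its initial node \<open>u\<close> and its arcs in the order in which they are
  traversed; \<open>u\<close> is kept so that a walk of length 0 is also determined by the pair.
\<close>

definition walks_to :: "('a, 'b) pre_digraph \<Rightarrow> 'a \<Rightarrow> nat \<Rightarrow> ('a \<times> 'b list) set" where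
  "walks_to G v l = {(u, p). pre_digraph.awalk G u p v \<and> length p = l}"

end

theory Submission
  imports Defs
begin

text \<open>
  Let \<open>x l v\<close> be the number of walks of length \<open>l\<close> that end at \<open>v\<close>. With \<open>A\<close> the adjacency
  matrix, \<open>x l\<close> is the row vector of column sums of \<open>A ^ l\<close>
  (\<open>card_walks_to_eq_column_sum\<close>), so \<open>x (l + 1)\<close> is \<open>x l\<close> times \<open>A\<close>. Strong connectivity
  and period 1 make all sufficiently high powers of \<open>A\<close> entrywise positive
  (\<open>irreducible_aperiodic_primitive\<close>): the lengths of closed walks at one node form an
  additively closed set of greatest common divisor 1, which contains all large numbers, and
  every node can be joined to that node in both directions.

  The growth of \<open>x\<close> can be read off from its ratios. The ratio
  \<open>x (l + 1) v / x l v\<close> is a weighted average over \<open>u\<close> of the ratios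
  \<open>x l u / x (l - 1) u\<close>. Hence the intervals spanned by the ratios over all nodes \<open>v\<close>
  are nested. If \<open>A ^ N\<close> is positive, then over \<open>N\<close> steps, as soon as \<open>l \<ge> N\<close>, every
  ratio takes part in every average with a weight bounded below, so the length of the interval
  drops by a fixed factor. The ratios therefore tend to a common limit \<open>r\<close>, and their distances to
  \<open>r\<close> are summable; consequently \<open>ln (x l v) - l * ln r\<close> converges and
  \<open>x l v / r ^ l\<close> has a positive limit \<open>c v\<close> (\<open>positive_recursion_geometric\<close>).

  The recursion for \<open>x\<close> passes to the limit and says that \<open>c\<close> is a positive left
  eigenvector of \<open>A\<close> with eigenvalue \<open>r\<close>. Pairing \<open>c\<close> with the absolute values of an
  arbitrary eigenvector shows that no eigenvalue exceeds \<open>r\<close> in modulus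
  (\<open>spectral_radius_eq_positive_left_eigenvalue\<close>), so \<open>r\<close> is the Perron eigenvalue.
\<close>

section \<open>Ratios of consecutive terms of a nonnegative linear recursion\<close>

definition lo_ratio :: "'a set \<Rightarrow> ('a \<Rightarrow> real) \<Rightarrow> ('a \<Rightarrow> real) \<Rightarrow> real" where
  "lo_ratio V y z = Min ((\<lambda>u. z u / y u) ` V)"

definition hi_ratio :: "'a set \<Rightarrow> ('a \<Rightarrow> real) \<Rightarrow> ('a \<Rightarrow> real) \<Rightarrow> real" where
  "hi_ratio V y z = Max ((\<lambda>u. z u / y u) ` V)"

lemma lo_ratio_le_ratio: "finite V \<Longrightarrow> u \<in> V \<Longrightarrow> lo_ratio V y z \<le> z u / y u"
  and ratio_le_hi_ratio: "finite V \<Longrightarrow> u \<in> V \<Longrightarrow> z u / y u \<le> hi_ratio V y z"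
  by (auto simp: lo_ratio_def hi_ratio_def)

lemma hi_ratio_neg:
  assumes "finite V" "V \<noteq> {}"
  shows "hi_ratio V y z = - lo_ratio V y (\<lambda>u. - z u)"
proof -
  let ?R = "(\<lambda>u. - z u / y u) ` V"
  have "(\<lambda>u. z u / y u) ` V = uminus ` ?R"
    by (simp add: image_image)
  thus ?thesis
    using assms unfolding hi_ratio_def lo_ratio_def by (simp del: minus_divide_left)
qed

text \<open>
  The entries of \<open>z'\<close> over those of \<open>y'\<close> are weighted averages of the ratios \<open>z u / y u\<close>, with
  weights proportional to \<open>P u v * y u\<close>. The bound for the largest ratio follows by changing
  the sign of \<open>z\<close>.
\<close>

lemma lo_ratio_mono:
  fixes P :: "'a \<Rightarrow> 'a \<Rightarrow> real"
  assumes V: "finite V" "V \<noteq> {}"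
    and P: "\<And>u v. u \<in> V \<Longrightarrow> v \<in> V \<Longrightarrow> P u v \<ge> 0"
    and y: "\<And>u. u \<in> V \<Longrightarrow> y u > 0" and y': "\<And>v. v \<in> V \<Longrightarrow> y' v > 0"
    and y'_eq: "\<And>v. v \<in> V \<Longrightarrow> y' v = (\<Sum>u\<in>V. P u v * y u)"
    and z'_eq: "\<And>v. v \<in> V \<Longrightarrow> z' v = (\<Sum>u\<in>V. P u v * z u)"
  shows "lo_ratio V y z \<le> lo_ratio V y' z'"
proof -
  let ?m = "lo_ratio V y z"
  have "?m \<le> z' v / y' v" if v: "v \<in> V" for v
  proof -
    have "?m * y' v = (\<Sum>u\<in>V. P u v * (?m * y u))"
      by (simp add: y'_eq[OF v] sum_distrib_left mult.left_commute)
    also have "\<dots> \<le> (\<Sum>u\<in>V. P u v * z u)"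
      using lo_ratio_le_ratio[OF V(1), of _ y z] y P v
      by (intro sum_mono mult_left_mono) (auto simp: pos_le_divide_eq)
    finally show ?thesis using y'[OF v] by (simp add: z'_eq[OF v] pos_le_divide_eq)
  qed
  thus ?thesis using V unfolding lo_ratio_def[of V y'] by simp
qed

lemma hi_ratio_mono:
  fixes P :: "'a \<Rightarrow> 'a \<Rightarrow> real"
  assumes V: "finite V" "V \<noteq> {}"
    and P: "\<And>u v. u \<in> V \<Longrightarrow> v \<in> V \<Longrightarrow> P u v \<ge> 0"
    and y: "\<And>u. u \<in> V \<Longrightarrow> y u > 0" and y': "\<And>v. v \<in> V \<Longrightarrow> y' v > 0"
    and y'_eq: "\<And>v. v \<in> V \<Longrightarrow> y' v = (\<Sum>u\<in>V. P u v * y u)"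
    and z'_eq: "\<And>v. v \<in> V \<Longrightarrow> z' v = (\<Sum>u\<in>V. P u v * z u)"
  shows "hi_ratio V y' z' \<le> hi_ratio V y z"
proof -
  have "lo_ratio V y (\<lambda>u. - z u) \<le> lo_ratio V y' (\<lambda>u. - z' u)"
    by (rule lo_ratio_mono[OF V P y y' y'_eq]) (auto simp: z'_eq sum_negf)
  thus ?thesis by (simp add: hi_ratio_neg[OF V])
qed

text \<open>
  A Doeblin type argument: in each of the averages that give the new ratios, every old ratio has
  weight at least \<open>\<delta>\<close>, in particular the largest one. This lifts the smallest ratio by the
  fraction \<open>\<delta>\<close> of the gap, while the largest ratio does not increase.
\<close>

lemma ratio_gap_contraction:
  fixes P :: "'a \<Rightarrow> 'a \<Rightarrow> real"
  assumes V: "finite V" "V \<noteq> {}"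
    and P: "\<And>u v. u \<in> V \<Longrightarrow> v \<in> V \<Longrightarrow> P u v \<ge> 0"
    and y: "\<And>u. u \<in> V \<Longrightarrow> y u > 0" and y': "\<And>v. v \<in> V \<Longrightarrow> y' v > 0"
    and y'_eq: "\<And>v. v \<in> V \<Longrightarrow> y' v = (\<Sum>u\<in>V. P u v * y u)"
    and z'_eq: "\<And>v. v \<in> V \<Longrightarrow> z' v = (\<Sum>u\<in>V. P u v * z u)"
    and \<delta>: "\<And>u v. u \<in> V \<Longrightarrow> v \<in> V \<Longrightarrow> \<delta> * y' v \<le> P u v * y u"
  shows "hi_ratio V y' z' - lo_ratio V y' z' \<le> (1 - \<delta>) * (hi_ratio V y z - lo_ratio V y z)"
proof -
  let ?m = "lo_ratio V y z" and ?M = "hi_ratio V y z"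
  have "?M \<in> (\<lambda>u. z u / y u) ` V"
    unfolding hi_ratio_def using V by (intro Max_in) auto
  then obtain w where w: "w \<in> V" "?M = z w / y w" by auto
  have gap: "?m \<le> ?M"
    using lo_ratio_le_ratio[OF V(1) w(1), of y z] w(2) by simp
  have "?m + \<delta> * (?M - ?m) \<le> z' v / y' v" if v: "v \<in> V" for v
  proof -
    \<comment> \<open>All terms of the sum below are nonnegative, and the one at a node where the ratio is
      largest already carries the fraction \<open>\<delta>\<close> of the gap.\<close>
    have "\<delta> * y' v * (?M - ?m) \<le> P w v * y w * (?M - ?m)"
      using gap \<delta>[OF w(1) v] by (intro mult_right_mono) auto
    also have "\<dots> = P w v * (z w - ?m * y w)"
      using y[OF w(1)] w(2) by (simp add: field_simps)
    also have "\<dots> \<le> (\<Sum>u\<in>V. P u v * (z u - ?m * y u))"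
      using lo_ratio_le_ratio[OF V(1), of _ y z] y P v w(1)
      by (intro member_le_sum V mult_nonneg_nonneg) (auto simp: pos_le_divide_eq)
    also have "\<dots> = z' v - ?m * y' v"
      by (simp add: z'_eq[OF v] y'_eq[OF v] sum_distrib_left right_diff_distrib sum_subtractf
          mult.left_commute)
    finally have "(?m + \<delta> * (?M - ?m)) * y' v \<le> z' v" by (simp add: algebra_simps)
    thus ?thesis using y'[OF v] by (simp add: pos_le_divide_eq)
  qed
  hence "?m + \<delta> * (?M - ?m) \<le> lo_ratio V y' z'"
    using V unfolding lo_ratio_def[of V y'] by simp
  moreover have "hi_ratio V y' z' \<le> ?M"
    by (rule hi_ratio_mono[OF V P y y' y'_eq z'_eq])
  ultimately show ?thesis by (simp add: algebra_simps)
qed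

text \<open>
  Splitting off the first \<open>N\<close> terms bounds a partial sum \<open>S\<close> by a constant plus \<open>\<theta> * S\<close>.
\<close>

lemma summable_if_shift_contracts:
  fixes D :: "nat \<Rightarrow> real"
  assumes nonneg: "\<And>l. D l \<ge> 0" and "\<theta> < 1"
    and shift: "\<And>l. D (l + N) \<le> \<theta> * D l"
  shows "summable D"
proof (rule summableI_nonneg_bounded[OF nonneg])
  fix n
  let ?S = "\<lambda>n. \<Sum>l<n. D l"
  have "?S n \<le> ?S (N + n)"
    by (rule sum_mono2) (auto simp: nonneg)
  also have "\<dots> = ?S N + (\<Sum>l<n. D (l + N))"
    using sum.atLeastLessThan_concat[of 0 N "N + n" D] sum.shift_bounds_nat_ivl[of D 0 N n]
    by (simp add: atLeast0LessThan add.commute)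
  also have "\<dots> \<le> ?S N + \<theta> * ?S n"
    by (simp add: sum_distrib_left shift sum_mono)
  finally show "?S n \<le> ?S N / (1 - \<theta>)"
    using \<open>\<theta> < 1\<close> by (simp add: pos_le_divide_eq algebra_simps)
qed

lemma abs_ln_diff_le:
  fixes a b c :: real
  assumes "c > 0" "a \<ge> c" "b \<ge> c"
  shows "\<bar>ln a - ln b\<bar> \<le> \<bar>a - b\<bar> / c"
proof -
  have *: "ln s - ln t \<le> \<bar>s - t\<bar> / c" if "s \<ge> c" "t \<ge> c" for s t
  proof -
    have "ln s - ln t = ln (s / t)" using that assms by (simp add: ln_div)
    also have "\<dots> \<le> s / t - 1" using that assms by (intro ln_le_minus_one) simp
    also have "\<dots> = (s - t) / t" using that assms by (simp add: field_simps)
    also have "\<dots> \<le> \<bar>s - t\<bar> / t" using that assms by (simp add: divide_right_mono)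
    also have "\<dots> \<le> \<bar>s - t\<bar> / c" using that assms by (simp add: frac_le)
    finally show ?thesis .
  qed
  show ?thesis using *[of a b] *[of b a] assms by (simp add: abs_le_iff abs_minus_commute)
qed

text \<open>
  The positive kernel \<open>P\<close> stands for \<open>N\<close> steps of the recursion with kernel \<open>B\<close>. The kernel
  \<open>B\<close> keeps the intervals of ratios nested, and \<open>P\<close> makes their lengths contract
  geometrically, so that the logarithms of the ratios minus \<open>ln r\<close> are summable. Their partial
  sums telescope to \<open>ln (x l v / r ^ l)\<close> up to a constant.
\<close>

lemma positive_recursion_geometric:
  fixes B P :: "'a \<Rightarrow> 'a \<Rightarrow> real" and x :: "nat \<Rightarrow> 'a \<Rightarrow> real"
  assumes V: "finite V" "V \<noteq> {}"
    and B: "\<And>u v. u \<in> V \<Longrightarrow> v \<in> V \<Longrightarrow> B u v \<ge> 0"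
    and P: "\<And>u v. u \<in> V \<Longrightarrow> v \<in> V \<Longrightarrow> P u v > 0"
    and x_pos: "\<And>l v. v \<in> V \<Longrightarrow> x l v > 0"
    and x_Suc: "\<And>l v. v \<in> V \<Longrightarrow> x (Suc l) v = (\<Sum>u\<in>V. B u v * x l u)"
    and x_add: "\<And>l v. v \<in> V \<Longrightarrow> x (l + N) v = (\<Sum>u\<in>V. P u v * x l u)"
  obtains r C where "r > 0" "\<And>v. v \<in> V \<Longrightarrow> C v > 0"
    "\<And>v. v \<in> V \<Longrightarrow> (\<lambda>l. x l v / r ^ l) \<longlonglongrightarrow> C v"
proof -
  define lo where "lo l = lo_ratio V (x l) (x (Suc l))" for l
  define hi where "hi l = hi_ratio V (x l) (x (Suc l))" for l
  define D where "D l = hi l - lo l" for l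
  have lo_le: "lo l \<le> x (Suc l) v / x l v" and le_hi: "x (Suc l) v / x l v \<le> hi l"
    if "v \<in> V" for l v
    using lo_ratio_le_ratio[OF V(1) that] ratio_le_hi_ratio[OF V(1) that]
    unfolding lo_def hi_def by auto
  have lo_le_hi: "lo l \<le> hi l" for l
    using V(2) lo_le[of _ l] le_hi[of _ l] by (meson all_not_in_conv order_trans)
  have lo_pos: "lo l > 0" for l
    using V x_pos unfolding lo_def lo_ratio_def by simp
  have lo_Suc: "lo l \<le> lo (Suc l)" for l
    unfolding lo_def by (rule lo_ratio_mono[OF V B x_pos x_pos x_Suc x_Suc])
  have hi_Suc: "hi (Suc l) \<le> hi l" for l
    unfolding hi_def by (rule hi_ratio_mono[OF V B x_pos x_pos x_Suc x_Suc])

  define p where "p = Min (case_prod P ` (V \<times> V))"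
  define q where "q = Max (case_prod P ` (V \<times> V))"
  have p_le: "p \<le> P u v" and le_q: "P u v \<le> q" if "u \<in> V" "v \<in> V" for u v
    using that V unfolding p_def q_def by (auto intro!: Min_le Max_ge)
  have p_pos: "p > 0" using V P unfolding p_def by auto
  have pq: "p \<le> q" using V p_le le_q by (meson all_not_in_conv order_trans)
  define n where "n = real (card V)"
  have n: "n \<ge> 1" using V unfolding n_def by (simp add: Suc_leI card_gt_0_iff)
  define \<delta> where "\<delta> = p\<^sup>2 / (n * q\<^sup>2)"
  have q_pos: "q > 0" using p_pos pq by simp
  have \<delta>_pos: "\<delta> > 0" using p_pos q_pos n unfolding \<delta>_def by simp
  \<comment> \<open>After one application of \<open>P\<close> the entries of \<open>x\<close> differ from their total \<open>s\<close> by factors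
    between \<open>p\<close> and \<open>q\<close>; this makes the contraction factor independent of \<open>l\<close>.\<close>
  have \<delta>: "\<delta> * x (l + N + N) v \<le> P u v * x (l + N) u" if u: "u \<in> V" and v: "v \<in> V" for l u v
  proof -
    define s where "s = (\<Sum>u\<in>V. x l u)"
    have s: "s \<ge> 0" unfolding s_def by (intro sum_nonneg less_imp_le[OF x_pos])
    have up: "x (l + N) t \<le> q * s" if "t \<in> V" for t
      unfolding s_def sum_distrib_left x_add[OF that]
      using that x_pos by (intro sum_mono mult_right_mono le_q) (auto intro: less_imp_le)
    have low: "p * s \<le> x (l + N) t" if "t \<in> V" for t
      unfolding s_def sum_distrib_left x_add[OF that]
      using that x_pos by (intro sum_mono mult_right_mono p_le) (auto intro: less_imp_le)
    have "x (l + N + N) v \<le> (\<Sum>t\<in>V. q * (q * s))"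
      unfolding x_add[OF v, of "l + N"]
      using v up le_q q_pos x_pos by (intro sum_mono mult_mono) (auto intro: less_imp_le)
    also have "\<dots> = n * q\<^sup>2 * s" by (simp add: n_def power2_eq_square)
    finally have "\<delta> * x (l + N + N) v \<le> \<delta> * (n * q\<^sup>2 * s)"
      using \<delta>_pos by (intro mult_left_mono) auto
    also have "\<dots> = p * (p * s)"
      using n q_pos unfolding \<delta>_def by (simp add: power2_eq_square)
    also have "\<dots> \<le> P u v * x (l + N) u"
      using p_pos s p_le[OF u v] low[OF u] by (intro mult_mono) auto
    finally show ?thesis .
  qed
  have "D (l + N + N) \<le> (1 - \<delta>) * D (l + N)" for l
    unfolding D_def hi_def lo_def
    using x_add[of _ "Suc (l + N)"]
    by (intro ratio_gap_contraction[OF V less_imp_le[OF P] x_pos x_pos x_add _ \<delta>]) auto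
  hence "summable (\<lambda>l. D (l + N))"
    using lo_le_hi \<delta>_pos
    by (intro summable_if_shift_contracts[where \<theta> = "1 - \<delta>" and N = N]) (auto simp: D_def)
  hence D_sum: "summable D" by (simp add: summable_iff_shift)

  have "(\<lambda>l. lo l - hi l) \<longlonglongrightarrow> 0"
    using tendsto_minus[OF summable_LIMSEQ_zero[OF D_sum]] unfolding D_def by simp
  then obtain r where r: "\<And>l. lo l \<le> r" "\<And>l. r \<le> hi l"
    using nested_sequence_unique[of lo hi] lo_Suc hi_Suc lo_le_hi by metis
  have r_pos: "r > 0" using r(1)[of 0] lo_pos[of 0] by simp
  have lo0: "lo 0 \<le> lo l" for l
    by (rule lift_Suc_mono_le[of lo]) (auto simp: lo_Suc)
  define c where "c v l = ln (x (Suc l) v / x l v) - ln r" for v l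
  have c_sum: "summable (c v)" if v: "v \<in> V" for v
  proof (rule summable_comparison_test[OF _ summable_divide[OF D_sum, of "lo 0"]], intro exI allI impI)
    fix l
    have "\<bar>c v l\<bar> \<le> \<bar>x (Suc l) v / x l v - r\<bar> / lo 0"
      unfolding c_def using lo_pos lo0[of l] lo_le[OF v, of l] r(1)[of l]
      by (intro abs_ln_diff_le) auto
    also have "\<dots> \<le> D l / lo 0"
      using lo_pos[of 0] lo_le[OF v, of l] le_hi[OF v, of l] r[of l]
      by (intro divide_right_mono) (auto simp: D_def)
    finally show "norm (c v l) \<le> D l / lo 0" by simp
  qed
  have telescope: "x l v / r ^ l = x 0 v * exp (\<Sum>k<l. c v k)" if v: "v \<in> V" for l v
  proof (induction l)
    case (Suc l)
    have "exp (c v l) = x (Suc l) v / x l v / r"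
      using x_pos[OF v] r_pos by (simp add: c_def exp_diff)
    thus ?case using Suc x_pos[OF v, of l] r_pos by (simp add: exp_add field_simps)
  qed simp
  have "(\<lambda>l. x l v / r ^ l) \<longlonglongrightarrow> x 0 v * exp (suminf (c v))" if v: "v \<in> V" for v
    unfolding telescope[OF v] by (intro tendsto_intros summable_LIMSEQ c_sum v)
  moreover have "x 0 v * exp (suminf (c v)) > 0" if "v \<in> V" for v
    using x_pos[OF that] by simp
  ultimately show thesis by (rule that[OF r_pos, rotated])
qed

section \<open>Primitive nonnegative matrices\<close>

lemma mult_mat_entry:
  assumes "A \<in> carrier_mat n n" "B \<in> carrier_mat n n" "i < n" "j < n"
  shows "(A * B) $$ (i, j) = (\<Sum>k<n. A $$ (i, k) * B $$ (k, j))"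
  using assms by (auto simp: scalar_prod_def atLeast0LessThan)

lemma pow_mat_add:
  fixes A :: "'a::semiring_1 mat"
  assumes A: "A \<in> carrier_mat n n"
  shows "A ^\<^sub>m (k + l) = A ^\<^sub>m k * A ^\<^sub>m l"
proof (induction l)
  case 0
  show ?case using A by (simp add: pow_carrier_mat[OF A])
next
  case (Suc l)
  thus ?case using A by (simp add: assoc_mult_mat[OF pow_carrier_mat[OF A] pow_carrier_mat[OF A] A])
qed

lemma pow_mat_add_entry:
  fixes A :: "'a::semiring_1 mat"
  assumes A: "A \<in> carrier_mat n n" and "i < n" "j < n"
  shows "(A ^\<^sub>m (a + b)) $$ (i, j) = (\<Sum>k<n. (A ^\<^sub>m a) $$ (i, k) * (A ^\<^sub>m b) $$ (k, j))"
  unfolding pow_mat_add[OF A] using assms by (intro mult_mat_entry pow_carrier_mat) auto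

lemma pow_mat_nonneg:
  fixes A :: "real mat"
  assumes A: "A \<in> carrier_mat n n"
    and nonneg: "\<And>i j. i < n \<Longrightarrow> j < n \<Longrightarrow> A $$ (i, j) \<ge> 0"
    and ij: "i < n" "j < n"
  shows "(A ^\<^sub>m l) $$ (i, j) \<ge> 0"
  using ij
proof (induction l arbitrary: i j)
  case (Suc l)
  thus ?case
    using mult_mat_entry[OF pow_carrier_mat[OF A, of l] A Suc.prems]
    by (auto intro!: sum_nonneg mult_nonneg_nonneg nonneg)
qed (use A in auto)

lemma pow_mat_add_entry_ge:
  fixes A :: "real mat"
  assumes A: "A \<in> carrier_mat n n"
    and nonneg: "\<And>i j. i < n \<Longrightarrow> j < n \<Longrightarrow> A $$ (i, j) \<ge> 0"
    and ij: "i < n" "k < n" "j < n"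
  shows "(A ^\<^sub>m a) $$ (i, k) * (A ^\<^sub>m b) $$ (k, j) \<le> (A ^\<^sub>m (a + b)) $$ (i, j)"
  unfolding pow_mat_add_entry[OF A ij(1,3)]
  using ij by (intro member_le_sum[of k "{..<n}" "\<lambda>k. (A ^\<^sub>m a) $$ (i, k) * (A ^\<^sub>m b) $$ (k, j)"])
    (auto intro!: mult_nonneg_nonneg pow_mat_nonneg[OF A nonneg])

text \<open>
  If \<open>A z = e z\<close>, then \<open>\<bar>e\<bar> * \<bar>z\<bar> \<le> A \<bar>z\<bar>\<close> entrywise because \<open>A\<close> is nonnegative. Taking the
  product with the left eigenvector \<open>c\<close> gives \<open>\<bar>e\<bar> * s \<le> r * s\<close> for the number
  \<open>s = c \<bar>z\<bar>\<close>, which is positive since \<open>c\<close> is and \<open>z\<close> is not zero.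
\<close>

lemma spectral_radius_eq_positive_left_eigenvalue:
  fixes A :: "real mat"
  assumes A: "A \<in> carrier_mat n n" and n: "n > 0"
    and nonneg: "\<And>i j. i < n \<Longrightarrow> j < n \<Longrightarrow> A $$ (i, j) \<ge> 0"
    and c: "\<And>j. j < n \<Longrightarrow> c j > 0"
    and left: "\<And>j. j < n \<Longrightarrow> (\<Sum>i<n. c i * A $$ (i, j)) = r * c j"
  shows "spectral_radius (map_mat complex_of_real A) = r"
proof (rule antisym)
  let ?A = "map_mat complex_of_real A"
  have cA: "?A \<in> carrier_mat n n" using A by simp
  note max = spectral_radius_mem_max[OF cA n]
  have "r * c 0 \<ge> 0"
    unfolding left[OF n, symmetric] using n c nonneg
    by (intro sum_nonneg mult_nonneg_nonneg) (auto intro: less_imp_le)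
  hence r: "r \<ge> 0" using c[OF n] by (simp add: zero_le_mult_iff)

  obtain e where e: "eigenvalue ?A e" "spectral_radius ?A = norm e"
    using max(1) by (auto simp: spectrum_def)
  then obtain z where z: "z \<in> carrier_vec n" "z \<noteq> 0\<^sub>v n" "?A *\<^sub>v z = e \<cdot>\<^sub>v z"
    using A unfolding eigenvalue_def eigenvector_def by auto
  have ez: "e * z $ i = (\<Sum>k<n. of_real (A $$ (i, k)) * z $ k)" if i: "i < n" for i
  proof -
    have "e * z $ i = (?A *\<^sub>v z) $ i" using z i by simp
    also have "\<dots> = (\<Sum>k<n. of_real (A $$ (i, k)) * z $ k)"
      using A z(1) i by (auto simp: scalar_prod_def atLeast0LessThan)
    finally show ?thesis .
  qed
  define s where "s = (\<Sum>i<n. c i * norm (z $ i))"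
  have "\<exists>i<n. z $ i \<noteq> 0" using z(1,2) by (metis carrier_vecD eq_vecI index_zero_vec)
  then obtain i0 where i0: "i0 < n" "z $ i0 \<noteq> 0" by blast
  have "0 < c i0 * norm (z $ i0)" using i0 c by simp
  also have "\<dots> \<le> s"
    unfolding s_def using i0(1) c
    by (intro member_le_sum[of i0 "{..<n}" "\<lambda>i. c i * norm (z $ i)"])
      (auto intro!: mult_nonneg_nonneg less_imp_le[OF c])
  finally have s: "s > 0" .
  have "norm e * s = (\<Sum>i<n. c i * norm (e * z $ i))"
    by (simp add: s_def sum_distrib_left norm_mult mult.left_commute)
  also have "\<dots> \<le> (\<Sum>i<n. c i * (\<Sum>k<n. A $$ (i, k) * norm (z $ k)))"
  proof (intro sum_mono mult_left_mono)
    fix i assume i: "i \<in> {..<n}"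
    have "norm (e * z $ i) \<le> (\<Sum>k<n. norm (of_real (A $$ (i, k)) * z $ k))"
      using i by (simp only: ez lessThan_iff) (rule norm_sum)
    also have "\<dots> = (\<Sum>k<n. A $$ (i, k) * norm (z $ k))"
      using i nonneg by (intro sum.cong) (auto simp: norm_mult)
    finally show "norm (e * z $ i) \<le> (\<Sum>k<n. A $$ (i, k) * norm (z $ k))" .
  qed (use c in \<open>auto intro: less_imp_le\<close>)
  also have "\<dots> = (\<Sum>k<n. (\<Sum>i<n. c i * A $$ (i, k)) * norm (z $ k))"
    unfolding sum_distrib_left sum_distrib_right
    by (subst sum.swap) (simp add: mult.assoc)
  also have "\<dots> = r * s"
    by (simp add: left s_def sum_distrib_left mult.assoc)
  finally show "spectral_radius ?A \<le> r" using s e(2) by simp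

  \<comment> \<open>A matrix and its transpose have the same eigenvalues, so the left eigenvalue \<open>r\<close> counts.\<close>
  let ?c = "vec n (\<lambda>j. complex_of_real (c j))"
  have "transpose_mat ?A *\<^sub>v ?c = of_real r \<cdot>\<^sub>v ?c"
  proof (rule eq_vecI)
    fix j assume "j < dim_vec (of_real r \<cdot>\<^sub>v ?c)"
    hence j: "j < n" by simp
    have "(transpose_mat ?A *\<^sub>v ?c) $ j = (\<Sum>i<n. of_real (A $$ (i, j)) * of_real (c i))"
      using A j by (auto simp: scalar_prod_def atLeast0LessThan)
    also have "\<dots> = of_real (\<Sum>i<n. c i * A $$ (i, j))"
      by (simp add: mult.commute)
    also have "\<dots> = (of_real r \<cdot>\<^sub>v ?c) $ j" using j by (simp add: left)
    finally show "(transpose_mat ?A *\<^sub>v ?c) $ j = (of_real r \<cdot>\<^sub>v ?c) $ j" .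
  qed (use A in auto)
  moreover have "?c \<noteq> 0\<^sub>v n"
  proof
    assume "?c = 0\<^sub>v n"
    hence "?c $ 0 = 0\<^sub>v n $ 0" by simp
    thus False using n c[OF n] by simp
  qed
  ultimately have "eigenvalue (transpose_mat ?A) (of_real r)"
    using A unfolding eigenvalue_def eigenvector_def by (intro exI[of _ ?c]) auto
  hence "eigenvalue ?A (of_real r)"
    using cA by (simp add: eigenvalue_root_char_poly)
  hence "norm (complex_of_real r) \<le> spectral_radius ?A"
    by (intro max(2) imageI) (simp add: spectrum_def)
  thus "r \<le> spectral_radius ?A" using r by simp
qed

text \<open>
  The column sums obey a recursion with kernel \<open>A\<close>, whose \<open>N\<close>-step kernel is positive by
  primitivity; the growth rate that this recursion yields is identified as the spectral radius
  through the left eigenvector formed by the limits.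
\<close>

lemma primitive_column_sum_asymp:
  fixes A :: "real mat"
  assumes A: "A \<in> carrier_mat n n"
    and nonneg: "\<And>i j. i < n \<Longrightarrow> j < n \<Longrightarrow> A $$ (i, j) \<ge> 0"
    and primitive: "\<And>m i j. m \<ge> N \<Longrightarrow> i < n \<Longrightarrow> j < n \<Longrightarrow> (A ^\<^sub>m m) $$ (i, j) > 0"
    and j: "j < n"
  shows "\<exists>C::real. C > 0 \<and> (\<lambda>l. \<Sum>i<n. (A ^\<^sub>m l) $$ (i, j)) \<sim>[at_top]
    (\<lambda>l. C * spectral_radius (map_mat complex_of_real A) ^ l)"
proof -
  define x where "x l j = (\<Sum>i<n. (A ^\<^sub>m l) $$ (i, j))" for l j
  have x_add: "x (l + m) v = (\<Sum>u<n. (A ^\<^sub>m m) $$ (u, v) * x l u)" if v: "v < n" for l m v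
  proof -
    have "x (l + m) v = (\<Sum>i<n. \<Sum>u<n. (A ^\<^sub>m l) $$ (i, u) * (A ^\<^sub>m m) $$ (u, v))"
      unfolding x_def using v by (intro sum.cong refl pow_mat_add_entry[OF A]) auto
    also have "\<dots> = (\<Sum>u<n. (A ^\<^sub>m m) $$ (u, v) * x l u)"
      unfolding x_def sum_distrib_left by (subst sum.swap) (simp add: mult.commute)
    finally show ?thesis .
  qed
  have x_nonneg: "x l v \<ge> 0" if "v < n" for l v
    unfolding x_def using that by (auto intro!: sum_nonneg pow_mat_nonneg[OF A nonneg])
  \<comment> \<open>A vanishing column sum would be a vanishing column, which then vanishes in all
    higher powers as well.\<close>
  have x_pos: "x l v > 0" if v: "v < n" for l v
  proof (rule ccontr)
    assume "\<not> x l v > 0"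
    hence "x l v = 0" using x_nonneg[OF v, of l] by simp
    hence zero: "(A ^\<^sub>m l) $$ (i, v) = 0" if "i < n" for i
      using that v unfolding x_def
      by (subst (asm) sum_nonneg_eq_0_iff) (auto intro: pow_mat_nonneg[OF A nonneg])
    have "(A ^\<^sub>m (N + l)) $$ (v, v) = 0"
      unfolding pow_mat_add_entry[OF A v v] by (simp add: zero)
    thus False using primitive[of "N + l" v v] v by simp
  qed
  have x_Suc: "x (Suc l) v = (\<Sum>u<n. A $$ (u, v) * x l u)" if "v < n" for l v
    using x_add[OF that, of l 1] A by simp
  obtain r c where r: "r > 0" and c: "\<And>v. v < n \<Longrightarrow> c v > 0"
    and lim: "\<And>v. v < n \<Longrightarrow> (\<lambda>l. x l v / r ^ l) \<longlonglongrightarrow> c v"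
    using positive_recursion_geometric[of "{..<n}" "\<lambda>u v. A $$ (u, v)"
        "\<lambda>u v. (A ^\<^sub>m N) $$ (u, v)" x N] j nonneg primitive[of N] x_pos x_Suc x_add
    by (auto simp: lessThan_empty_iff)
  \<comment> \<open>Dividing the recursion by \<open>r ^ l\<close> and passing to the limit shows that the limits form
    a left eigenvector.\<close>
  have left: "(\<Sum>u<n. c u * A $$ (u, v)) = r * c v" if v: "v < n" for v
  proof (rule LIMSEQ_unique)
    show "(\<lambda>l. \<Sum>u<n. x l u / r ^ l * A $$ (u, v)) \<longlonglongrightarrow> (\<Sum>u<n. c u * A $$ (u, v))"
      by (intro tendsto_intros lim) auto
    have "(\<lambda>l. r * (x (Suc l) v / r ^ Suc l)) \<longlonglongrightarrow> r * c v"
      using LIMSEQ_Suc[OF lim[OF v]] by (intro tendsto_intros)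
    moreover have "r * (x (Suc l) v / r ^ Suc l) = (\<Sum>u<n. x l u / r ^ l * A $$ (u, v))" for l
      using r by (simp add: x_Suc[OF v] sum_divide_distrib sum_distrib_left field_simps)
    ultimately show "(\<lambda>l. \<Sum>u<n. x l u / r ^ l * A $$ (u, v)) \<longlonglongrightarrow> r * c v" by simp
  qed
  have "spectral_radius (map_mat complex_of_real A) = r"
    using j by (intro spectral_radius_eq_positive_left_eigenvalue[OF A _ nonneg c left]) auto
  moreover have "(\<lambda>l. x l j) \<sim>[at_top] (\<lambda>l. c j * r ^ l)"
    using c[OF j] by (intro asymp_equivI'_const lim j) auto
  ultimately show ?thesis using c[OF j] unfolding x_def by blast
qed

section \<open>Irreducible aperiodic matrices are primitive\<close>

text \<open>
  Adjoin 0 to \<open>S\<close> and consider the least positive difference \<open>d\<close> of two elements. Division with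
  remainder by \<open>d\<close> would produce a smaller difference from any element that is not a multiple
  of \<open>d\<close>, so \<open>d\<close> divides the greatest common divisor and equals 1. Two consecutive elements
  \<open>a\<close> and \<open>a + 1\<close> with \<open>a > 0\<close> then generate every number \<open>m = q * a + r\<close> with \<open>r < a \<le> q\<close>, in
  the form \<open>(q - r) * a + r * (a + 1)\<close>.
\<close>

lemma Gcd_1_add_closed_cofinite:
  fixes S :: "nat set"
  assumes add: "\<And>a b. a \<in> S \<Longrightarrow> b \<in> S \<Longrightarrow> a + b \<in> S" and gcd: "Gcd S = 1"
  shows "\<exists>M. \<forall>m\<ge>M. m \<in> S \<or> m = 0"
proof -
  define T where "T = insert 0 S"
  have T_add: "a + b \<in> T" if "a \<in> T" "b \<in> T" for a b
    using that add unfolding T_def by auto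
  have T_mult: "q * a \<in> T" if "a \<in> T" for q a
    by (induction q) (use that T_add in \<open>auto simp: T_def\<close>)
  have "\<not> S \<subseteq> {0}" using gcd Gcd_0_iff[of S] by auto
  then obtain s0 where s0: "s0 \<in> S" "s0 > 0" by auto
  let ?gap = "\<lambda>d. d > 0 \<and> (\<exists>a\<in>T. a + d \<in> T)"
  define d where "d = (LEAST d. ?gap d)"
  have "?gap s0" using s0 by (auto simp: T_def)
  hence d: "?gap d" unfolding d_def by (rule LeastI)
  then obtain a where a: "a \<in> T" "a + d \<in> T" "d > 0" by blast
  have "d dvd s" if s: "s \<in> S" for s
  proof (rule ccontr)
    assume nd: "\<not> d dvd s"
    \<comment> \<open>The remainder of \<open>s\<close> is the difference of \<open>s + q * a\<close> and \<open>q * (a + d)\<close>, where \<open>q\<close> is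
      the quotient.\<close>
    have "(s div d) * (a + d) + s mod d = s + (s div d) * a"
      by (simp add: algebra_simps)
    moreover have "s + (s div d) * a \<in> T"
      using s by (intro T_add T_mult a(1)) (simp add: T_def)
    ultimately have "?gap (s mod d)"
      using nd T_mult[OF a(2)]
      by (auto simp: mod_greater_zero_iff_not_dvd intro!: bexI[of _ "(s div d) * (a + d)"])
    hence "d \<le> s mod d" unfolding d_def by (rule Least_le)
    thus False using mod_less_divisor[OF a(3), of s] by linarith
  qed
  hence "d dvd Gcd S" by (rule Gcd_greatest)
  hence d1: "a + 1 \<in> T" using a gcd by simp
  have "m \<in> T" if m: "m \<ge> a * a" for m
  proof (cases "a = 0")
    case True
    thus ?thesis using T_mult[OF d1, of m] by simp
  next
    case False
    let ?q = "m div a" and ?r = "m mod a"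
    have "?r < a" using False by simp
    also have "a \<le> ?q" using m False by (simp add: less_eq_div_iff_mult_less_eq)
    finally have "?r * a \<le> ?q * a" by simp
    hence "(?q - ?r) * a + ?r * (a + 1) = ?q * a + ?r"
      by (simp add: diff_mult_distrib)
    also have "\<dots> = m" by simp
    finally show ?thesis using T_add T_mult a(1) d1 by metis
  qed
  thus ?thesis unfolding T_def by blast
qed

text \<open>
  To get from \<open>i\<close> to \<open>j\<close> in \<open>m\<close> steps, go from \<open>i\<close> to \<open>k\<close>, return to \<open>k\<close> in the
  number of steps that is left over, and go from \<open>k\<close> to \<open>j\<close>. Every sufficiently large number
  of steps is possible for the return.
\<close>

lemma irreducible_aperiodic_primitive:
  fixes A :: "real mat"
  assumes A: "A \<in> carrier_mat n n"
    and nonneg: "\<And>i j. i < n \<Longrightarrow> j < n \<Longrightarrow> A $$ (i, j) \<ge> 0"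
    and irreducible: "\<And>i j. i < n \<Longrightarrow> j < n \<Longrightarrow> \<exists>m. (A ^\<^sub>m m) $$ (i, j) > 0"
    and k: "k < n" and aperiodic: "Gcd {m. m > 0 \<and> (A ^\<^sub>m m) $$ (k, k) > 0} = 1"
  shows "\<exists>N. \<forall>m\<ge>N. \<forall>i<n. \<forall>j<n. (A ^\<^sub>m m) $$ (i, j) > 0"
proof -
  have trans: "(A ^\<^sub>m (a + b)) $$ (i, j) > 0"
    if "(A ^\<^sub>m a) $$ (i, t) > 0" "(A ^\<^sub>m b) $$ (t, j) > 0" "i < n" "t < n" "j < n" for a b i j t
    using pow_mat_add_entry_ge[OF A nonneg that(3-5), of a b] mult_pos_pos[OF that(1,2)] by linarith
  obtain M where M: "\<And>m. m \<ge> M \<Longrightarrow> (A ^\<^sub>m m) $$ (k, k) > 0 \<or> m = 0"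
    using Gcd_1_add_closed_cofinite[OF _ aperiodic] trans[OF _ _ k k k] by auto
  obtain into where into: "\<And>i. i < n \<Longrightarrow> (A ^\<^sub>m into i) $$ (i, k) > 0"
    using irreducible[OF _ k] by metis
  obtain out where out: "\<And>j. j < n \<Longrightarrow> (A ^\<^sub>m out j) $$ (k, j) > 0"
    using irreducible[OF k] by metis
  define N where "N = Suc M + (\<Sum>i<n. into i) + (\<Sum>j<n. out j)"
  have "(A ^\<^sub>m m) $$ (i, j) > 0" if m: "m \<ge> N" and i: "i < n" and j: "j < n" for m i j
  proof -
    have "into i \<le> (\<Sum>i<n. into i)" "out j \<le> (\<Sum>j<n. out j)"
      using i j by (auto intro: member_le_sum)
    hence *: "m - into i - out j \<ge> Suc M" "m = into i + (m - into i - out j) + out j"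
      using m unfolding N_def by auto
    have "(A ^\<^sub>m (m - into i - out j)) $$ (k, k) > 0" using M[of "m - into i - out j"] *(1) by auto
    hence "(A ^\<^sub>m (into i + (m - into i - out j) + out j)) $$ (i, j) > 0"
      using into out i j k by (intro trans[where t = k]) auto
    thus ?thesis using *(2) by simp
  qed
  thus ?thesis by blast
qed

section \<open>Counting walks\<close>

lemma finite_walks_of_length:
  assumes "fin_digraph G"
  shows "finite {p. pre_digraph.awalk G u p v \<and> length p = l}"
proof -
  interpret fin_digraph G by fact
  show ?thesis
    by (rule finite_subset[OF _ finite_lists_length_eq[OF finite_arcs, of l]]) (auto simp: awalk_def)
qed

text \<open>
  Removing the last arc splits a walk of length \<open>l + 1\<close> into a walk of length \<open>l\<close> to some node
  \<open>vs ! k\<close> and an arc from there to \<open>vs ! j\<close>, which is the expansion of \<open>A ^ l * A\<close>.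
\<close>

lemma card_walks_eq_pow_adjacency_matrix:
  assumes fin: "fin_digraph G" and vs: "distinct vs" "set vs = verts G"
    and i: "i < length vs" and j: "j < length vs"
  shows "card {p. pre_digraph.awalk G (vs ! i) p (vs ! j) \<and> length p = l}
    = (adjacency_matrix G vs ^\<^sub>m l) $$ (i, j)"
proof -
  interpret fin_digraph G by fact
  show ?thesis using j
  proof (induction l arbitrary: j)
    case 0
    have "{p. awalk (vs ! i) p (vs ! j) \<and> length p = 0} = (if i = j then {[]} else {})"
      using vs i 0 nth_eq_iff_index_eq[OF vs(1) i 0] by (auto simp: awalk_Nil_iff)
    thus ?case using i 0 by (simp add: adjacency_matrix_def)
  next
    case (Suc l)
    let ?n = "length vs" and ?A = "adjacency_matrix G vs"
    have A: "?A \<in> carrier_mat ?n ?n" by (simp add: adjacency_matrix_def)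
    let ?W = "\<lambda>w. {p. awalk (vs ! i) p w \<and> length p = l}"
    let ?E = "\<lambda>k. {e \<in> arcs G. tail G e = vs ! k \<and> head G e = vs ! j}"
    have "bij_betw (\<lambda>(k, e, p). p @ [e]) (SIGMA k:{..<?n}. ?E k \<times> ?W (vs ! k))
      {p. awalk (vs ! i) p (vs ! j) \<and> length p = Suc l}" (is "bij_betw ?f ?X ?Y")
      unfolding bij_betw_def
    proof
      show "inj_on ?f ?X"
        using vs(1) by (auto simp: inj_on_def nth_eq_iff_index_eq)
      show "?f ` ?X = ?Y"
      proof (intro equalityI subsetI)
        fix p assume "p \<in> ?f ` ?X"
        then obtain k e q where "p = q @ [e]" "e \<in> arcs G" "tail G e = vs ! k" "head G e = vs ! j"
          "awalk (vs ! i) q (vs ! k)" "length q = l" by auto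
        thus "p \<in> ?Y" using arc_implies_awalk[of e] by (auto intro!: awalk_appendI)
      next
        fix p assume p: "p \<in> ?Y"
        then obtain q e where q: "p = q @ [e]" "length q = l"
          by (cases p rule: rev_cases) auto
        define w where "w = awlast (vs ! i) q"
        have *: "awalk (vs ! i) q w" "awalk w [e] (vs ! j)" using p q unfolding w_def by auto
        hence "w \<in> set vs" using awalk_last_in_verts vs(2) by auto
        then obtain k where "k < ?n" "vs ! k = w" by (auto simp: in_set_conv_nth)
        thus "p \<in> ?f ` ?X"
          using * q by (intro image_eqI[of _ _ "(k, e, q)"]) (auto simp: awalk_Cons_iff awalk_Nil_iff)
      qed
    qed
    hence "card ?Y = card ?X" by (simp add: bij_betw_same_card)
    also have "\<dots> = (\<Sum>k<?n. card (?E k) * card (?W (vs ! k)))"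
      using finite_walks_of_length[OF fin] by (subst card_SigmaI) (auto simp: card_cartesian_product)
    also have "\<dots> = (\<Sum>k<?n. (?A ^\<^sub>m l) $$ (i, k) * ?A $$ (k, j))"
      using Suc by (intro sum.cong) (auto simp: adjacency_matrix_def)
    also have "\<dots> = (?A ^\<^sub>m Suc l) $$ (i, j)"
      using mult_mat_entry[OF pow_carrier_mat[OF A] A i Suc.prems] by simp
    finally show ?case .
  qed
qed

lemma card_walks_to_eq_column_sum:
  assumes fin: "fin_digraph G" and vs: "distinct vs" "set vs = verts G" and j: "j < length vs"
  shows "card (walks_to G (vs ! j) l) = (\<Sum>i<length vs. (adjacency_matrix G vs ^\<^sub>m l) $$ (i, j))"
proof -
  interpret fin_digraph G by fact
  let ?W = "\<lambda>u. {p. awalk u p (vs ! j) \<and> length p = l}"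
  have "walks_to G (vs ! j) l = Sigma (verts G) ?W"
    unfolding walks_to_def by (auto simp: awalk_def)
  hence "card (walks_to G (vs ! j) l) = (\<Sum>u\<in>set vs. card (?W u))"
    using finite_walks_of_length[OF fin] by (simp add: card_SigmaI vs(2))
  also have "\<dots> = (\<Sum>i<length vs. card (?W (vs ! i)))"
    using vs(1) by (intro sum.reindex_bij_betw[symmetric] bij_betw_nth) auto
  finally show ?thesis
    using card_walks_eq_pow_adjacency_matrix[OF fin vs _ j] by simp
qed

theorem corollary8p2:
  fixes G :: "('a, 'b) pre_digraph" and vs :: "'a list" and k :: nat and v :: 'a
  assumes "fin_digraph G"
    and "distinct vs" and "set vs = verts G"
    and "strongly_connected G"
    and "k < length vs" and "period_at G vs k = 1"
    and "v \<in> verts G"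
  shows "\<exists>C::real. C > 0 \<and>
    (\<lambda>l. real (card (walks_to G v l))) \<sim>[at_top] (\<lambda>l. C * perron_eigenvalue G vs ^ l)"
proof -
  interpret fin_digraph G by fact
  note vs = assms(2,3) and k = assms(5)
  define n where "n = length vs"
  define A where "A = map_mat real (adjacency_matrix G vs)"
  have carrier: "adjacency_matrix G vs \<in> carrier_mat n n"
    by (simp add: adjacency_matrix_def n_def)
  hence A: "A \<in> carrier_mat n n" by (simp add: A_def)
  have hom: "semiring_hom (of_nat :: nat \<Rightarrow> real)" by unfold_locales auto
  have A_pow: "(A ^\<^sub>m m) $$ (i, j) = real ((adjacency_matrix G vs ^\<^sub>m m) $$ (i, j))"
    if "i < n" "j < n" for m i j
    using that carrier unfolding A_def semiring_hom.mat_hom_pow[OF hom carrier, symmetric] by simp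
  have nonneg: "A $$ (i, j) \<ge> 0" if "i < n" "j < n" for i j
    using that carrier by (simp add: A_def)
  have irreducible: "\<exists>m. (A ^\<^sub>m m) $$ (i, j) > 0" if i: "i < n" and j: "j < n" for i j
  proof -
    have "vs ! i \<rightarrow>\<^sup>*\<^bsub>G\<^esub> vs ! j"
      using assms(4) i j nth_mem[of _ vs] unfolding strongly_connected_def n_def vs(2) by blast
    then obtain p where "awalk (vs ! i) p (vs ! j)" unfolding reachable_awalk by blast
    hence "p \<in> {q. awalk (vs ! i) q (vs ! j) \<and> length q = length p}" by simp
    hence "card {q. awalk (vs ! i) q (vs ! j) \<and> length q = length p} > 0"
      using finite_walks_of_length[OF assms(1)] by (auto simp: card_gt_0_iff)
    thus ?thesis
      using A_pow[OF i j] i j card_walks_eq_pow_adjacency_matrix[OF assms(1) vs, of i j "length p"]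
      unfolding n_def by (intro exI[of _ "length p"]) simp
  qed
  have "Gcd {m. m > 0 \<and> (A ^\<^sub>m m) $$ (k, k) > 0} = 1"
    using assms(6) k A_pow[of k k] unfolding period_at_def n_def by simp
  then obtain N where N: "\<And>m i j. m \<ge> N \<Longrightarrow> i < n \<Longrightarrow> j < n \<Longrightarrow> (A ^\<^sub>m m) $$ (i, j) > 0"
    using irreducible_aperiodic_primitive[OF A nonneg irreducible] k n_def by blast
  obtain j where j: "j < n" "vs ! j = v"
    using assms(7) vs(2) unfolding n_def by (metis in_set_conv_nth)
  have "real (card (walks_to G v l)) = (\<Sum>i<n. (A ^\<^sub>m l) $$ (i, j))" for l
    using card_walks_to_eq_column_sum[OF assms(1) vs, of j l] j A_pow by (simp add: n_def)
  moreover have "map_mat complex_of_real A = map_mat of_nat (adjacency_matrix G vs)"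
    using carrier by (intro eq_matI) (auto simp: A_def)
  ultimately show ?thesis
    using primitive_column_sum_asymp[OF A nonneg N j(1)] unfolding perron_eigenvalue_def by simp
qed

end
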